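(* Let $A=[X|\mathbf{y}]$ be an $m\times(\ell+1)$ real matrix with rows $\mathbf{a}_1,\dots,\mathbf{a}_m$, and let $\mathcal{L}(A,\beta)=\sum_{i=1}^m\mathcal{L}(\mathbf{a}_i,\beta)$ be a loss function of $\beta\in\mathbb{R}^\ell$. Suppose that Stochastic Gradient Coding (SGC) is run on $A$ with $n$ workers, with each row $\mathbf{a}_i$ sent to $d_i$ different workers, $d_i\le n$, according to a pair-wise balanced distribution scheme. Let $\mathcal{W}\subset\mathbb{R}^\ell$ be a bounded convex set, let $$\beta^*=\arg\min_{\beta\in\mathcal{W}}\mathcal{L}(A,\beta),$$ and suppose that at each step of the algorithm $\beta_{t+1}=\Pi_{\mathcal{W}}(\beta_t-\gamma_t\hat{\mathbf{g}}_t)$, where $\Pi_{\mathcal{W}}$ is the projection onto $\mathcal{W}$ and $\hat{\mathbf{g}}_t$ is the SGC gradient estimate. Let $p$ be the probability of a given worker being a straggler at a given iteration, independently between workers and between iterations. Suppose that $\mathcal{L}(A,\cdot)$ is $\lambda$-strongly convex, and that there is a constant $C$ such that $$\|\nabla\mathcal{L}(\mathbf{a}_i,\beta)\|_2^2\le C^2\qquad\text{for all }\beta\in\mathcal{W},\ i\in\{1,\dots,m\}.$$ Suppose that the step size is $\gamma_t=1/(\lambda t)$. Then the error after $T$ iterations is bounded by $$\mathbb{E}\|\beta_T-\beta^*\|_2^2\le\frac{4}{\lambda^2T}\cdot mC^2\left(\frac{p}{1-p}\cdot\frac{1}{d_{\min}}+\frac{(m-1)p}{n(1-p)}+m\right),$$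 where $d_{\min}=\min_{1\le i\le m}d_i$.
   Context: $0\le p<1$, $\lambda>0$, each $d_i$ is a positive integer, and gradients are with respect to $\beta$. The projection $\Pi_{\mathcal{W}}$ is Euclidean and is assumed to be well defined. Expectations are over the stragglers in all iterations. Strong convexity: a function $\mathcal{L}$ of $\beta\in\mathbb{R}^\ell$ is $\lambda$-strongly convex if for all $\beta,\beta'\in\mathbb{R}^\ell$ and any subgradient $\mathbf{g}$ of $\mathcal{L}$ at $\beta$, $\mathcal{L}(\beta')\ge\mathcal{L}(\beta)+\langle\mathbf{g},\beta'-\beta\rangle+\frac{\lambda}{2}\|\beta'-\beta\|_2^2$. Pair-wise balanced scheme: a distribution scheme that sends each row $\mathbf{a}_i$ to $d_i$ different workers (out of $n$) is pair-wise balanced if for all $i\ne i'$ the number of workers that receive both $\mathbf{a}_i$ and $\mathbf{a}_{i'}$ is exactly $\frac{d_id_{i'}}{n}$. The distribution is fixed before the iterations begin. SGC gradient estimate: at each iteration $t$ the master sends $\beta_t$ to all workers, each non-straggling worker returns the corresponding weighted sum of gradients of the rows it holds, and the master forms $$\hat{\mathbf{g}}_t=\sum_{j=1}^n\sum_{i=1}^m\frac{\mathcal{I}_i^j}{d_i(1-p)}\nabla\mathcal{L}(\mathbf{a}_i,\beta_t),$$ where $\mathcal{I}_i^j$ (depending on $t$) equals $1$ if worker $j$ is not a straggler at iteration $t$ and holds row $\mathbf{a}_i$, and $0$ otherwise. With the step size $\gamma_t=1/(\lambda t)$ the iterates are indexed $t=1,2,\dots$, starting from an initial point $\beta_1\i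n\mathcal{W}$.
   Formalization: Strong convexity is taken to include convexity of the loss; the subgradient condition alone holds vacuously for functions with no subgradient, such as -x^2, for which the bound fails. *)

theory Defs
  imports "HOL-Probability.Probability"
begin

(* The matrix [X | y]; the extra column is indexed by Inr (). *)
definition augment_col :: "real ^ 'l ^ 'm \<Rightarrow> real ^ 'm \<Rightarrow> real ^ ('l + unit) ^ 'm" where
  "augment_col X y = (\<chi> i k. case k of Inl j \<Rightarrow> X $ i $ j | Inr _ \<Rightarrow> y $ i)"

definition total_loss ::
  "(real ^ ('l + unit) \<Rightarrow> real ^ 'l \<Rightarrow> real) \<Rightarrow> real ^ ('l + unit) ^ 'm \<Rightarrow> real ^ 'l \<Rightarrow> real" where
  "total_loss loss A \<beta> = (\<Sum>i\<in>UNIV. loss (row i A) \<beta>)"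

definition is_subgradient :: "('b::real_inner \<Rightarrow> real) \<Rightarrow> 'b \<Rightarrow> 'b \<Rightarrow> bool" where
  "is_subgradient f x g \<longleftrightarrow> (\<forall>y. f y \<ge> f x + g \<bullet> (y - x))"

(* Convexity is required explicitly: a function without subgradients, such as -x^2,
   would satisfy the second clause vacuously for every lam. *)
definition strongly_convex :: "real \<Rightarrow> ('b::real_inner \<Rightarrow> real) \<Rightarrow> bool" where
  "strongly_convex lam f \<longleftrightarrow>
     convex_on UNIV f \<and>
     (\<forall>x y g. is_subgradient f x g \<longrightarrow>
        f y \<ge> f x + g \<bullet> (y - x) + lam / 2 * (norm (y - x))\<^sup>2)"

(* S i is the set of workers that receive row i. *)
definition pairwise_balanced :: "('m::finite \<Rightarrow> nat) \<Rightarrow> ('m \<Rightarrow> 'n::finite set) \<Rightarrow> bool" where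
  "pairwise_balanced d S \<longleftrightarrow>
     (\<forall>i. card (S i) = d i) \<and>
     (\<forall>i i'. i \<noteq> i' \<longrightarrow>
        real (card (S i \<inter> S i')) = real (d i) * real (d i') / real CARD('n))"

(* straggles j: worker j is a straggler in the iteration at hand;
   G i: gradient of the loss of row i at the current point. *)
definition sgc_estimate ::
  "real \<Rightarrow> ('m::finite \<Rightarrow> nat) \<Rightarrow> ('m \<Rightarrow> 'n::finite set) \<Rightarrow> ('n \<Rightarrow> bool) \<Rightarrow>
   ('m \<Rightarrow> real ^ 'l) \<Rightarrow> real ^ 'l" where
  "sgc_estimate p d S straggles G =
     (\<Sum>j\<in>UNIV. \<Sum>i\<in>UNIV.
        (of_bool (\<not> straggles j \<and> j \<in> S i) / (real (d i) * (1 - p))) *\<^sub>R G i)"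

(* Every point has exactly one nearest point in W; the library's closest_point is then
   the Euclidean projection onto W. *)
definition projection_well_defined :: "'b::metric_space set \<Rightarrow> bool" where
  "projection_well_defined W \<longleftrightarrow> (\<forall>x. \<exists>!w. w \<in> W \<and> (\<forall>z\<in>W. dist x w \<le> dist x z))"

end

theory Submission
  imports Defs
begin

text \<open>
  Write \<open>g\<close> for the full gradient at \<open>\<beta> t\<close>. Strong convexity at \<open>\<beta> t\<close> and at \<open>\<beta>star\<close>, together with the
  first-order optimality of \<open>\<beta>star\<close> on \<open>W\<close>, gives \<open>lam * |\<beta> t - \<beta>star|\<^sup>2 \<le> g \<bullet> (\<beta> t - \<beta>star)\<close>.
  Given the past, the estimate is a sum of independently switched worker contributions \<open>v j\<close> with mean
  \<open>g\<close> and second moment \<open>|g|\<^sup>2 + p (1 - p) (\<Sum>j. |v j|\<^sup>2)\<close>; expanding the squares counts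
  the workers shared by two rows, and pair-wise balancedness turns this into a bound \<open>B\<close>.
  Since the projection does not increase the distance to \<open>\<beta>star\<close>, the mean squared errors satisfy
  \<open>a (t + 1) \<le> (1 - 2 / t) a t + B / (lam t)\<^sup>2\<close>, whence \<open>a t \<le> 4 B / (lam\<^sup>2 t)\<close>;
  the initial error is bounded by the first inequality and Cauchy-Schwarz.
\<close>

section \<open>Gradients, convexity and first-order optimality\<close>

lemma GDERIV_sum:
  assumes "\<And>i. i \<in> I \<Longrightarrow> GDERIV (f i) x :> g i"
  shows "GDERIV (\<lambda>x. \<Sum>i\<in>I. f i x) x :> (\<Sum>i\<in>I. g i)"
  using assms unfolding gderiv_def inner_sum_right by (intro has_derivative_sum)

text \<open>Restriction to a line makes the facts about derivatives of real functions of one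
  variable available: tangents of convex functions and the sign of a slope.\<close>

lemma GDERIV_along_line:
  assumes "GDERIV f x :> g"
  shows "((\<lambda>s. f (x + s *\<^sub>R v)) has_real_derivative g \<bullet> v) (at 0)"
proof -
  have "((\<lambda>s::real. x + s *\<^sub>R v) has_derivative (\<lambda>s. s *\<^sub>R v)) (at 0)"
    by (auto intro!: derivative_eq_intros)
  moreover have "(f has_derivative (\<lambda>h. h \<bullet> g)) (at (x + 0 *\<^sub>R v))"
    using assms by (simp add: gderiv_def)
  ultimately have "((\<lambda>s. f (x + s *\<^sub>R v)) has_derivative (\<lambda>s. (s *\<^sub>R v) \<bullet> g)) (at 0)"
    by (rule has_derivative_compose)
  moreover have "(\<lambda>s. (s *\<^sub>R v) \<bullet> g) = (*) (g \<bullet> v)"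
    by (rule ext) (simp add: inner_commute)
  ultimately show ?thesis by (simp add: has_field_derivative_def)
qed

text \<open>Along the segment from \<open>x\<close> to \<open>y\<close> the function is convex in
  one real variable and so lies above its tangent at 0. Strong convexity is stated for subgradients,
  so gradients have to be recognised as such before it can be applied.\<close>

lemma convex_GDERIV_is_subgradient:
  assumes "convex_on UNIV f" "GDERIV f x :> g"
  shows "is_subgradient f x g"
  unfolding is_subgradient_def
proof
  fix y
  let ?\<phi> = "\<lambda>s. f (x + s *\<^sub>R (y - x))"
  have "convex_on UNIV ?\<phi>"
  proof (rule convex_onI)
    fix t a b :: real
    assume "0 < t" "t < 1"
    have "x + ((1 - t) *\<^sub>R a + t *\<^sub>R b) *\<^sub>R (y - x)
        = (1 - t) *\<^sub>R (x + a *\<^sub>R (y - x)) + t *\<^sub>R (x + b *\<^sub>R (y - x))"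
      by (simp add: algebra_simps)
    then show "?\<phi> ((1 - t) *\<^sub>R a + t *\<^sub>R b) \<le> (1 - t) * ?\<phi> a + t * ?\<phi> b"
      using convex_onD[OF assms(1), of t "x + a *\<^sub>R (y - x)" "x + b *\<^sub>R (y - x)"] \<open>0 < t\<close> \<open>t < 1\<close>
      by simp
  qed auto
  from convex_on_imp_above_tangent[OF this, of 0 1 "g \<bullet> (y - x)"] GDERIV_along_line[OF assms(2)]
  show "f y \<ge> f x + g \<bullet> (y - x)" by simp
qed

text \<open>A negative slope towards \<open>x\<close> would give points of \<open>W\<close> close to
  \<open>z\<close> with a smaller value than \<open>f z\<close>.\<close>

lemma GDERIV_minimum_on_convex:
  assumes "convex W" "z \<in> W" "x \<in> W" "\<And>w. w \<in> W \<Longrightarrow> f z \<le> f w" "GDERIV f z :> g"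
  shows "0 \<le> g \<bullet> (x - z)"
proof (rule ccontr)
  assume "\<not> ?thesis"
  then have "g \<bullet> (x - z) < 0" by simp
  from DERIV_neg_dec_right[OF GDERIV_along_line[OF assms(5)] this]
  obtain e where e: "e > 0" "\<And>h. 0 < h \<Longrightarrow> h < e \<Longrightarrow> f (z + h *\<^sub>R (x - z)) < f z" by auto
  \<comment> \<open>Half of \<open>e\<close> stays inside the interval of decrease; the cap at 1
    stays on the segment from \<open>z\<close> to \<open>x\<close>, hence in
    \<open>W\<close>.\<close>
  define h where "h = min (e / 2) 1"
  have h: "0 < h" "h < e" "h \<le> 1" using e(1) by (auto simp: h_def)
  have "z + h *\<^sub>R (x - z) = (1 - h) *\<^sub>R z + h *\<^sub>R x" by (simp add: algebra_simps)
  also have "\<dots> \<in> W" using assms(1-3) h by (intro convexD) auto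
  finally show False using assms(4) e(2)[OF h(1,2)] by (simp add: leD)
qed

text \<open>On adding the strong convexity inequalities from \<open>z\<close> to \<open>x\<close>
  and from \<open>x\<close> to \<open>z\<close>, the function values cancel and the two halves of
  \<open>lam\<close> add up; optimality of \<open>z\<close> disposes of the term with
  \<open>gz\<close>.\<close>

lemma strongly_convex_inner_minimizer:
  assumes "strongly_convex lam f" "convex W" "z \<in> W" "x \<in> W" "\<And>w. w \<in> W \<Longrightarrow> f z \<le> f w"
    and "GDERIV f z :> gz" "GDERIV f x :> gx"
  shows "lam * (norm (x - z))\<^sup>2 \<le> gx \<bullet> (x - z)"
proof -
  have sub: "is_subgradient f z gz" "is_subgradient f x gx"
    using assms(1,6,7) unfolding strongly_convex_def by (blast intro: convex_GDERIV_is_subgradient)+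
  have "f x \<ge> f z + gz \<bullet> (x - z) + lam / 2 * (norm (x - z))\<^sup>2"
    and "f z \<ge> f x + gx \<bullet> (z - x) + lam / 2 * (norm (z - x))\<^sup>2"
    using assms(1) sub unfolding strongly_convex_def by blast+
  moreover have "0 \<le> gz \<bullet> (x - z)" using assms(2-6) by (rule GDERIV_minimum_on_convex)
  moreover have "gx \<bullet> (z - x) = - (gx \<bullet> (x - z))" by (simp add: inner_diff_right)
  ultimately show ?thesis by (simp add: norm_minus_commute)
qed

section \<open>Euclidean projection onto \<open>W\<close>\<close>

text \<open>A point of the closure has points of \<open>W\<close> at arbitrarily small distance, so
  its nearest point in \<open>W\<close> is at distance 0.\<close>

lemma projection_well_defined_closed:
  assumes "projection_well_defined W"
  shows "closed W"
proof -
  have "x \<in> W" if x: "x \<in> closure W" for x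
  proof -
    obtain w where w: "w \<in> W" "\<forall>z\<in>W. dist x w \<le> dist x z"
      using assms unfolding projection_well_defined_def by blast
    have le: "dist x w \<le> e" if "e > 0" for e
    proof -
      obtain z where "z \<in> W" "dist z x < e" using x \<open>e > 0\<close> unfolding closure_approachable by blast
      with w(2) show ?thesis by (fastforce simp: dist_commute)
    qed
    have "dist x w \<le> 0" by (rule field_le_epsilon) (simp add: le)
    then show ?thesis using w(1) by simp
  qed
  then show ?thesis by (intro closure_subset_eq[THEN iffD1] subsetI)
qed

text \<open>Projection onto a closed convex set is 1-Lipschitz, and \<open>z\<close> is its own
  projection.\<close>

lemma dist_closest_point_le:
  fixes W :: "'b::{real_inner, heine_borel} set"
  assumes "convex W" "closed W" "z \<in> W"
  shows "dist (closest_point W x) z \<le> dist x z"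
  using closest_point_lipschitz[OF assms(1,2), of x z] assms(3) by (simp add: closest_point_self) blast

lemma norm_diff_scaleR_square:
  fixes x y :: "'b::real_inner"
  shows "(norm (x - c *\<^sub>R y))\<^sup>2 = (norm x)\<^sup>2 - 2 * c * (y \<bullet> x) + c\<^sup>2 * (norm y)\<^sup>2"
  unfolding power2_norm_eq_inner inner_diff_left inner_diff_right
  by (simp add: inner_commute power2_eq_square)

section \<open>Contributions of single workers and pair-wise balancedness\<close>

text \<open>With the straggler indicator split off, each contribution depends on the current point
  alone, and the new randomness of an iteration sits in scalar 0/1 factors.\<close>

definition worker_part :: "real \<Rightarrow> ('m::finite \<Rightarrow> nat) \<Rightarrow> ('m \<Rightarrow> 'n::finite set) \<Rightarrow>
    ('m \<Rightarrow> real ^ 'l) \<Rightarrow> 'n \<Rightarrow> real ^ 'l" where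
  "worker_part p d S G j = (\<Sum>i\<in>UNIV. (of_bool (j \<in> S i) / (real (d i) * (1 - p))) *\<^sub>R G i)"

lemma sgc_estimate_worker_part:
  "sgc_estimate p d S straggles G = (\<Sum>j\<in>UNIV. of_bool (\<not> straggles j) *\<^sub>R worker_part p d S G j)"
  by (simp add: sgc_estimate_def worker_part_def scaleR_sum_right of_bool_conj)

text \<open>Row \<open>i\<close> is held by \<open>d i\<close> workers with weight
  \<open>1 / (d i * (1 - p))\<close> each. As a worker responds with probability
  \<open>1 - p\<close>, this says that the estimate is unbiased.\<close>

lemma sum_worker_part:
  assumes "p \<noteq> 1" "\<And>i. 1 \<le> d i" "\<And>i. card (S i) = d i"
  shows "(1 - p) *\<^sub>R (\<Sum>j\<in>UNIV. worker_part p d S G j) = (\<Sum>i\<in>UNIV. G i)"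
proof -
  have d0: "d i \<noteq> 0" for i using assms(2)[of i] by simp
  have "(\<Sum>j\<in>UNIV. worker_part p d S G j)
      = (\<Sum>i\<in>UNIV. (\<Sum>j\<in>UNIV. of_bool (j \<in> S i) / (real (d i) * (1 - p))) *\<^sub>R G i)"
    unfolding worker_part_def by (subst sum.swap) (simp add: scaleR_sum_left)
  also have "\<dots> = (\<Sum>i\<in>UNIV. (1 / (1 - p)) *\<^sub>R G i)"
    by (simp add: sum_divide_distrib[symmetric] assms(3) d0)
  finally show ?thesis using assms(1) by (simp add: scaleR_sum_right[symmetric])
qed

text \<open>In the expanded squares the pair of rows \<open>i\<close>, \<open>k\<close> carries the
  weight \<open>card (S i \<inter> S k) / (d i * d k)\<close>. This is \<open>1 / d i\<close> on the
  diagonal and, by balancedness, exactly \<open>1 / n\<close> off it. The factor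
  \<open>(1 - p)^2\<close> cancels the scaling inside \<open>worker_part\<close>.\<close>

lemma sum_norm_worker_part:
  fixes S :: "'m::finite \<Rightarrow> 'n::finite set"
  assumes p: "p < 1" and d: "\<And>i. 1 \<le> d i" and bal: "pairwise_balanced d S"
    and G: "\<And>i. (norm (G i))\<^sup>2 \<le> C\<^sup>2"
  shows "(1 - p)\<^sup>2 * (\<Sum>j\<in>UNIV. (norm (worker_part p d S G j))\<^sup>2)
    \<le> real CARD('m) * C\<^sup>2 * (1 / real (Min (range d)) + (real CARD('m) - 1) / real CARD('n))"
proof -
  let ?c = "\<lambda>i k. real (card (S i \<inter> S k)) / (real (d i) * real (d k))"
  have d0: "d i \<noteq> 0" for i using d[of i] by simp
  have "(norm (worker_part p d S G j))\<^sup>2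
      = (\<Sum>i\<in>UNIV. \<Sum>k\<in>UNIV. of_bool (j \<in> S i \<inter> S k) / (real (d i) * real (d k) * (1 - p)\<^sup>2) * (G i \<bullet> G k))"
    for j
    unfolding worker_part_def power2_norm_eq_inner inner_sum_left inner_sum_right
    by (intro sum.cong refl) (auto simp: power2_eq_square inner_commute mult_ac)
  then have "(1 - p)\<^sup>2 * (\<Sum>j\<in>UNIV. (norm (worker_part p d S G j))\<^sup>2)
      = (\<Sum>j\<in>UNIV. \<Sum>i\<in>UNIV. \<Sum>k\<in>UNIV. of_bool (j \<in> S i \<inter> S k) * ((G i \<bullet> G k) / (real (d i) * real (d k))))"
    using p by (simp add: sum_distrib_left)
  also have "\<dots> = (\<Sum>i\<in>UNIV. \<Sum>k\<in>UNIV. \<Sum>j\<in>UNIV. of_bool (j \<in> S i \<inter> S k) * ((G i \<bullet> G k) / (real (d i) * real (d k))))"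
    by (subst sum.swap, rule sum.cong[OF refl sum.swap])
  also have "\<dots> = (\<Sum>i\<in>UNIV. \<Sum>k\<in>UNIV. ?c i k * (G i \<bullet> G k))"
  proof (intro sum.cong refl)
    fix i k
    show "(\<Sum>j\<in>UNIV. of_bool (j \<in> S i \<inter> S k) * ((G i \<bullet> G k) / (real (d i) * real (d k)))) = ?c i k * (G i \<bullet> G k)"
      unfolding sum_distrib_right[symmetric] by (simp add: Int_def)
  qed
  also have "\<dots> \<le> (\<Sum>i\<in>(UNIV::'m set). \<Sum>k\<in>(UNIV::'m set). C\<^sup>2 *
      (if i = k then 1 / real (Min (range d)) else 1 / real CARD('n)))"
  proof (intro sum_mono)
    fix i k
    have "G i \<bullet> G k \<le> norm (G i) * norm (G k)" by (rule norm_cauchy_schwarz)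
    \<comment> \<open>The sign of \<open>C\<close> is unknown, hence the absolute values.\<close>
    also have "\<dots> \<le> \<bar>C\<bar> * \<bar>C\<bar>"
      using G by (intro mult_mono) (auto intro: power2_le_imp_le)
    finally have GC: "G i \<bullet> G k \<le> C\<^sup>2" by (simp add: power2_eq_square)
    have c: "?c i k \<le> (if i = k then 1 / real (Min (range d)) else 1 / real CARD('n))"
    proof (cases "i = k")
      case True
      have "Min (range d) \<le> d i" "Min (range d) \<ge> 1" using d by auto
      then have "1 / real (d i) \<le> 1 / real (Min (range d))" by (intro frac_le) linarith+
      then show ?thesis using True bal d0 by (simp add: pairwise_balanced_def)
    next
      case False
      then show ?thesis using bal d0 by (simp add: pairwise_balanced_def)
    qed
    have "?c i k * (G i \<bullet> G k) \<le> ?c i k * C\<^sup>2" using GC by (intro mult_left_mono) auto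
    also have "\<dots> \<le> (if i = k then 1 / real (Min (range d)) else 1 / real CARD('n)) * C\<^sup>2"
      using c by (intro mult_right_mono) auto
    finally show "?c i k * (G i \<bullet> G k)
        \<le> C\<^sup>2 * (if i = k then 1 / real (Min (range d)) else 1 / real CARD('n))"
      by (simp only: mult.commute)
  qed
  also have "\<dots> = real CARD('m) * C\<^sup>2 * (1 / real (Min (range d)) + (real CARD('m) - 1) / real CARD('n))"
  proof -
    have "(\<Sum>k\<in>UNIV. if i = k then a else b) = a + (real CARD('m) - 1) * b" for i :: 'm and a b :: real
      by (subst sum.remove[of _ i]) (auto simp: card_Diff_singleton of_nat_diff)
    then show ?thesis by (simp add: sum_distrib_left[symmetric])
  qed
  finally show ?thesis .
qed

lemma norm_sum_le_card:
  fixes G :: "'m::finite \<Rightarrow> 'b::real_normed_vector"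
  assumes "\<And>i. (norm (G i))\<^sup>2 \<le> C\<^sup>2"
  shows "(norm (\<Sum>i\<in>UNIV. G i))\<^sup>2 \<le> (real CARD('m))\<^sup>2 * C\<^sup>2"
proof -
  have "norm (\<Sum>i\<in>UNIV. G i) \<le> (\<Sum>i\<in>(UNIV::'m set). \<bar>C\<bar>)"
    using assms by (intro sum_norm_le) (auto intro: power2_le_imp_le)
  then have "(norm (\<Sum>i\<in>UNIV. G i))\<^sup>2 \<le> (real CARD('m) * \<bar>C\<bar>)\<^sup>2"
    by (intro power_mono) auto
  then show ?thesis by (simp add: power_mult_distrib)
qed

section \<open>Moments of sums with independent random switches\<close>

context prob_space
begin

text \<open>The restricted family takes finitely many values in a discrete space, so every
  \<open>f\<close> of it is both measurable and bounded.\<close>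

lemma integrable_finite_restrict:
  fixes X :: "'i \<Rightarrow> 'a \<Rightarrow> 'c::finite" and f :: "('i \<Rightarrow> 'c) \<Rightarrow> real"
  assumes X: "\<And>i. i \<in> J \<Longrightarrow> random_variable (count_space UNIV) (X i)" and J: "finite J"
  shows "integrable M (\<lambda>\<omega>. f (\<lambda>i\<in>J. X i \<omega>))"
proof -
  have P: "PiM J (\<lambda>_. count_space (UNIV :: 'c set)) = count_space (PiE J (\<lambda>_. UNIV))"
    using J by (intro count_space_PiM_finite) auto
  have fin: "finite (PiE J (\<lambda>_. UNIV :: 'c set))" using J by (intro finite_PiE) auto
  have R: "(\<lambda>\<omega>. \<lambda>i\<in>J. X i \<omega>) \<in> M \<rightarrow>\<^sub>M count_space (PiE J (\<lambda>_. UNIV))"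
    unfolding P[symmetric] using X by (intro measurable_restrict) auto
  show ?thesis
  proof (rule integrable_const_bound)
    show "AE \<omega> in M. norm (f (\<lambda>i\<in>J. X i \<omega>)) \<le> (\<Sum>h\<in>PiE J (\<lambda>_. UNIV). norm (f h))"
      using fin by (intro AE_I2 member_le_sum) auto
    show "(\<lambda>\<omega>. f (\<lambda>i\<in>J. X i \<omega>)) \<in> borel_measurable M"
      by (rule measurable_compose[OF R]) simp
  qed
qed

text \<open>Families over disjoint index sets are independent, and \<open>f\<close> and
  \<open>g\<close> are automatically measurable on the discrete product spaces.\<close>

lemma expectation_mult_restrict:
  fixes X :: "'i \<Rightarrow> 'a \<Rightarrow> 'c::finite" and f g :: "('i \<Rightarrow> 'c) \<Rightarrow> real"
  assumes ind: "indep_vars (\<lambda>_. count_space UNIV) X I"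
    and JK: "J \<subseteq> I" "K \<subseteq> I" "J \<inter> K = {}" "finite J" "finite K"
  shows "expectation (\<lambda>\<omega>. f (\<lambda>i\<in>J. X i \<omega>) * g (\<lambda>i\<in>K. X i \<omega>))
    = expectation (\<lambda>\<omega>. f (\<lambda>i\<in>J. X i \<omega>)) * expectation (\<lambda>\<omega>. g (\<lambda>i\<in>K. X i \<omega>))"
proof -
  have P: "PiM L (\<lambda>_. count_space (UNIV :: 'c set)) = count_space (PiE L (\<lambda>_. UNIV))" if "finite L" for L :: "'i set"
    using that by (intro count_space_PiM_finite) auto
  have rv: "random_variable (count_space UNIV) (X i)" if "i \<in> I" for i
    using ind that unfolding indep_vars_def by blast
  have "indep_var borel (f \<circ> (\<lambda>\<omega>. \<lambda>i\<in>J. X i \<omega>)) borel (g \<circ> (\<lambda>\<omega>. \<lambda>i\<in>K. X i \<omega>))"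
    using JK by (intro indep_var_compose[OF indep_var_restrict[OF ind]]) (auto simp: P)
  then show ?thesis
    using JK rv by (subst indep_var_lebesgue_integral[symmetric])
      (auto simp: o_def intro!: integrable_finite_restrict)
qed

text \<open>This replaces conditioning on the past \<open>Z\<close>: the switches
  \<open>X (k j)\<close> have indices outside \<open>J\<close>, so their products factor out of the
  expectation. Two distinct switches contribute \<open>(1 - p)^2\<close>, a repeated one
  \<open>1 - p\<close>; the excess \<open>p * (1 - p)\<close> is the variance of one switch.\<close>

lemma weighted_sum_moments:
  fixes X :: "'i \<Rightarrow> 'a \<Rightarrow> bool" and k :: "'n::finite \<Rightarrow> 'i"
    and v :: "('i \<Rightarrow> bool) \<Rightarrow> 'n \<Rightarrow> 'b::real_inner" and u :: "('i \<Rightarrow> bool) \<Rightarrow> 'b"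
  assumes ind: "indep_vars (\<lambda>_. count_space UNIV) X I"
    and J: "J \<subseteq> I" "finite J" and k: "inj k" "range k \<subseteq> I" "J \<inter> range k = {}"
    and P: "\<And>j. prob {\<omega> \<in> space M. X (k j) \<omega>} = p"
  defines "Z \<equiv> \<lambda>\<omega>. \<lambda>i\<in>J. X i \<omega>"
  shows "expectation (\<lambda>\<omega>. (\<Sum>j\<in>UNIV. of_bool (\<not> X (k j) \<omega>) *\<^sub>R v (Z \<omega>) j) \<bullet> u (Z \<omega>))
      = expectation (\<lambda>\<omega>. ((1 - p) *\<^sub>R (\<Sum>j\<in>UNIV. v (Z \<omega>) j)) \<bullet> u (Z \<omega>))" (is ?inner)
    and "expectation (\<lambda>\<omega>. (norm (\<Sum>j\<in>UNIV. of_bool (\<not> X (k j) \<omega>) *\<^sub>R v (Z \<omega>) j))\<^sup>2)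
      = expectation (\<lambda>\<omega>. (norm ((1 - p) *\<^sub>R (\<Sum>j\<in>UNIV. v (Z \<omega>) j)))\<^sup>2
          + p * (1 - p) * (\<Sum>j\<in>UNIV. (norm (v (Z \<omega>) j))\<^sup>2))" (is ?square)
proof -
  define r where "r j \<omega> = (of_bool (\<not> X (k j) \<omega>) :: real)" for j \<omega>
  have rv: "random_variable (count_space UNIV) (X i)" if "i \<in> I" for i
    using ind that unfolding indep_vars_def by blast
  have int_Z: "integrable M (\<lambda>\<omega>. f (Z \<omega>))" for f :: "_ \<Rightarrow> real"
    unfolding Z_def using J rv by (intro integrable_finite_restrict) auto
  have int_rr: "integrable M (\<lambda>\<omega>. r j \<omega> * r l \<omega> * f (Z \<omega>))" for j l f
  proof -
    \<comment> \<open>Past and current switches are read off one joint finite family.\<close>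
    have "integrable M (\<lambda>\<omega>. (\<lambda>h. of_bool (\<not> h (k j)) * of_bool (\<not> h (k l)) * f (restrict h J))
        (\<lambda>i\<in>J \<union> range k. X i \<omega>))"
      using J k rv by (intro integrable_finite_restrict) auto
    then show ?thesis by (simp add: r_def Z_def restrict_restrict Int_absorb1)
  qed
  \<comment> \<open>Since \<open>r\<close> is 0/1-valued, first moments are the case
    \<open>j = l\<close> of second moments.\<close>
  have r_idem: "r j \<omega> * r j \<omega> = r j \<omega>" for j \<omega> by (simp add: r_def)
  have int_r: "integrable M (\<lambda>\<omega>. r j \<omega> * f (Z \<omega>))" for j f
    using int_rr[of j j f] by (simp add: r_idem)
  have Er: "expectation (r j) = 1 - p" for j
  proof -
    have ev: "{\<omega> \<in> space M. X (k j) \<omega>} \<in> events"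
      using measurable_sets[OF rv, of "k j" "{True}"] k(2) by (auto simp: vimage_def Int_def conj_commute)
    have "expectation (r j) = expectation (indicator (space M - {\<omega> \<in> space M. X (k j) \<omega>}))"
      by (intro Bochner_Integration.integral_cong) (auto simp: r_def)
    also have "\<dots> = 1 - p" using prob_compl[OF ev] P by (simp add: Int_absorb2 Diff_subset)
    finally show ?thesis .
  qed
  have Err: "expectation (\<lambda>\<omega>. r j \<omega> * r l \<omega>) = (if j = l then 1 - p else (1 - p)\<^sup>2)" for j l
  proof (cases "j = l")
    case False
    then have "{k j} \<inter> {k l} = {}" using k(1) by (auto dest: injD)
    from expectation_mult_restrict[OF ind _ _ this, of "\<lambda>h. of_bool (\<not> h (k j))" "\<lambda>h. of_bool (\<not> h (k l))"]
    have "expectation (\<lambda>\<omega>. r j \<omega> * r l \<omega>) = expectation (r j) * expectation (r l)"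
      using k(2) by (auto simp: r_def[abs_def])
    then show ?thesis using False by (simp add: Er power2_eq_square)
  qed (simp add: r_idem Er)
  have F2: "expectation (\<lambda>\<omega>. r j \<omega> * r l \<omega> * f (Z \<omega>))
      = (if j = l then 1 - p else (1 - p)\<^sup>2) * expectation (\<lambda>\<omega>. f (Z \<omega>))" for j l f
  proof -
    have "range k \<inter> J = {}" using k(3) by auto
    from expectation_mult_restrict[OF ind k(2) J(1) this _ J(2),
        of "\<lambda>h. of_bool (\<not> h (k j)) * of_bool (\<not> h (k l))" f]
    show ?thesis by (simp add: r_def Z_def Err[unfolded r_def])
  qed
  have F1: "expectation (\<lambda>\<omega>. r j \<omega> * f (Z \<omega>)) = (1 - p) * expectation (\<lambda>\<omega>. f (Z \<omega>))" for j f
    using F2[of j j f] by (simp add: r_idem)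
  have "expectation (\<lambda>\<omega>. (\<Sum>j\<in>UNIV. r j \<omega> *\<^sub>R v (Z \<omega>) j) \<bullet> u (Z \<omega>))
      = (\<Sum>j\<in>UNIV. expectation (\<lambda>\<omega>. r j \<omega> * (v (Z \<omega>) j \<bullet> u (Z \<omega>))))"
    unfolding inner_sum_left inner_scaleR_left
    by (intro Bochner_Integration.integral_sum int_r[of _ "\<lambda>z. v z _ \<bullet> u z"])
  also have "\<dots> = (\<Sum>j\<in>UNIV. expectation (\<lambda>\<omega>. (1 - p) * (v (Z \<omega>) j \<bullet> u (Z \<omega>))))"
    by (intro sum.cong refl) (simp add: F1[of _ "\<lambda>z. v z _ \<bullet> u z"])
  also have "\<dots> = expectation (\<lambda>\<omega>. ((1 - p) *\<^sub>R (\<Sum>j\<in>UNIV. v (Z \<omega>) j)) \<bullet> u (Z \<omega>))"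
    unfolding inner_scaleR_left inner_sum_left sum_distrib_left
    by (intro Bochner_Integration.integral_sum[symmetric] int_Z[of "\<lambda>z. (1 - p) * (v z _ \<bullet> u z)"])
  finally show ?inner by (simp add: r_def)

  define c where "c j l = (if j = l then 1 - p else (1 - p)\<^sup>2)" for j l :: 'n
  have "expectation (\<lambda>\<omega>. (norm (\<Sum>j\<in>UNIV. r j \<omega> *\<^sub>R v (Z \<omega>) j))\<^sup>2)
      = expectation (\<lambda>\<omega>. \<Sum>j\<in>UNIV. \<Sum>l\<in>UNIV. r j \<omega> * r l \<omega> * (v (Z \<omega>) j \<bullet> v (Z \<omega>) l))"
    by (simp add: power2_norm_eq_inner inner_sum_left inner_sum_right mult_ac inner_commute)
  also have "\<dots> = (\<Sum>j\<in>UNIV. \<Sum>l\<in>UNIV. expectation (\<lambda>\<omega>. r j \<omega> * r l \<omega> * (v (Z \<omega>) j \<bullet> v (Z \<omega>) l)))"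
    by (simp add: Bochner_Integration.integral_sum int_rr[of _ _ "\<lambda>z. v z _ \<bullet> v z _"])
  also have "\<dots> = (\<Sum>j\<in>UNIV. \<Sum>l\<in>UNIV. expectation (\<lambda>\<omega>. c j l * (v (Z \<omega>) j \<bullet> v (Z \<omega>) l)))"
    by (intro sum.cong refl) (simp add: F2[of _ _ "\<lambda>z. v z _ \<bullet> v z _"] c_def)
  also have "\<dots> = expectation (\<lambda>\<omega>. \<Sum>j\<in>UNIV. \<Sum>l\<in>UNIV. c j l * (v (Z \<omega>) j \<bullet> v (Z \<omega>) l))"
    by (simp add: Bochner_Integration.integral_sum int_Z[of "\<lambda>z. v z _ \<bullet> v z _"])
  also have "\<dots> = expectation (\<lambda>\<omega>. (norm ((1 - p) *\<^sub>R (\<Sum>j\<in>UNIV. v (Z \<omega>) j)))\<^sup>2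
          + p * (1 - p) * (\<Sum>j\<in>UNIV. (norm (v (Z \<omega>) j))\<^sup>2))"
  proof (intro Bochner_Integration.integral_cong refl)
    fix \<omega>
    have c: "c j l = (1 - p)\<^sup>2 + (if j = l then p * (1 - p) else 0)" for j l
      by (simp add: c_def power2_eq_square algebra_simps)
    have "(\<Sum>j\<in>UNIV. \<Sum>l\<in>UNIV. c j l * (v (Z \<omega>) j \<bullet> v (Z \<omega>) l))
        = (1 - p)\<^sup>2 * (\<Sum>j\<in>UNIV. \<Sum>l\<in>UNIV. v (Z \<omega>) j \<bullet> v (Z \<omega>) l)
          + p * (1 - p) * (\<Sum>j\<in>UNIV. v (Z \<omega>) j \<bullet> v (Z \<omega>) j)"
      unfolding c distrib_right sum.distrib
      by (simp add: sum_distrib_left if_distrib[of "\<lambda>x. x * _"] cong: if_cong)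
    then show "(\<Sum>j\<in>UNIV. \<Sum>l\<in>UNIV. c j l * (v (Z \<omega>) j \<bullet> v (Z \<omega>) l))
        = (norm ((1 - p) *\<^sub>R (\<Sum>j\<in>UNIV. v (Z \<omega>) j)))\<^sup>2
          + p * (1 - p) * (\<Sum>j\<in>UNIV. (norm (v (Z \<omega>) j))\<^sup>2)"
      by (simp add: power_mult_distrib power2_norm_eq_inner inner_sum_left inner_sum_right inner_commute)
  qed
  finally show ?square by (simp add: r_def)
qed

end

section \<open>The scalar recursion\<close>

text \<open>The step from 1 to 2 is separate because \<open>1 - 2 / t\<close> is negative there.\<close>

lemma sgd_recursion_bound:
  fixes a :: "nat \<Rightarrow> real"
  assumes D: "0 \<le> D" and a1: "0 \<le> a 1" "a 1 \<le> 4 * D"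
    and step: "\<And>t. 1 \<le> t \<Longrightarrow> a (Suc t) \<le> (1 - 2 / real t) * a t + D / (real t)\<^sup>2"
    and t: "1 \<le> t"
  shows "a t \<le> 4 * D / real t"
  using t
proof (induction t rule: dec_induct)
  case base
  then show ?case using a1 by simp
next
  case (step t)
  show ?case
  proof (cases "t = 1")
    case True
    \<comment> \<open>The coefficient is -1, so \<open>0 \<le> a 1\<close> leaves
      \<open>a 2 \<le> D\<close>, which is within \<open>4 * D / 2\<close>.\<close>
    then show ?thesis using assms(4)[of 1] a1(1) D by simp
  next
    case False
    with step.hyps have t: "real t \<ge> 2" by simp
    have "a (Suc t) \<le> (1 - 2 / real t) * a t + D / (real t)\<^sup>2" using assms(4) step.hyps by simp
    also have "\<dots> \<le> (1 - 2 / real t) * (4 * D / real t) + D / (real t)\<^sup>2"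
      using step.IH t by (intro add_right_mono mult_left_mono) auto
    also have "\<dots> = D * (4 * real t - 7) / (real t)\<^sup>2"
      using t by (simp add: field_simps power2_eq_square)
    also have "\<dots> \<le> 4 * D / real (Suc t)"
    proof -
      \<comment> \<open>The product of the two factors is \<open>4 t^2 - 3 t - 7\<close>.\<close>
      have "D * ((4 * real t - 7) * (real t + 1)) \<le> D * (4 * (real t)\<^sup>2)"
        using D t by (intro mult_left_mono) (auto simp: algebra_simps power2_eq_square)
      then have "D * (4 * real t - 7) * (real t + 1) \<le> 4 * D * (real t)\<^sup>2" by simp
      then show ?thesis using t by (simp add: frac_le_eq divide_simps add.commute)
    qed
    finally show ?thesis .
  qed
qed

section \<open>Convergence of the projected SGC iteration\<close>

theorem theorem5:
  fixes X :: "real ^ 'l ^ 'm" and y :: "real ^ 'm" and A :: "real ^ ('l + unit) ^ 'm"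
    and loss :: "real ^ ('l + unit) \<Rightarrow> real ^ 'l \<Rightarrow> real"
    and grad :: "real ^ ('l + unit) \<Rightarrow> real ^ 'l \<Rightarrow> real ^ 'l"
    and d :: "'m \<Rightarrow> nat" and S :: "'m \<Rightarrow> 'n::finite set"
    and W :: "(real ^ 'l) set" and \<beta>1 \<beta>star :: "real ^ 'l"
    and p lam C :: real and \<gamma> :: "nat \<Rightarrow> real"
    and M :: "'a measure" and straggler :: "nat \<Rightarrow> 'n \<Rightarrow> 'a \<Rightarrow> bool"
    and \<beta> :: "nat \<Rightarrow> 'a \<Rightarrow> real ^ 'l" and T :: nat
  assumes A: "A = augment_col X y"
    and p: "0 \<le> p" "p < 1" and lam: "lam > 0"
    and d: "\<And>i. 1 \<le> d i" "\<And>i. d i \<le> CARD('n)"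
    and balanced: "pairwise_balanced d S"
    and W: "bounded W" "convex W" "projection_well_defined W"
    and argmin: "is_arg_min (total_loss loss A) (\<lambda>b. b \<in> W) \<beta>star"
    and grad: "\<And>i b. b \<in> W \<Longrightarrow> GDERIV (loss (row i A)) b :> grad (row i A) b"
    and strong: "strongly_convex lam (total_loss loss A)"
    and grad_bound: "\<And>i b. b \<in> W \<Longrightarrow> (norm (grad (row i A) b))\<^sup>2 \<le> C\<^sup>2"
    and M: "prob_space M"
    and straggler_indep:
      "prob_space.indep_vars M (\<lambda>_. count_space UNIV) (\<lambda>(t, j). straggler t j) ({1..} \<times> UNIV)"
    and straggler_prob:
      "\<And>t j. 1 \<le> t \<Longrightarrow> measure M {\<omega> \<in> space M. straggler t j \<omega>} = p"
    and step_size: "\<And>t. 1 \<le> t \<Longrightarrow> \<gamma> t = 1 / (lam * real t)"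
    and init: "\<beta>1 \<in> W" "\<And>\<omega>. \<omega> \<in> space M \<Longrightarrow> \<beta> 1 \<omega> = \<beta>1"
    and step: "\<And>t \<omega>. 1 \<le> t \<Longrightarrow> \<omega> \<in> space M \<Longrightarrow>
      \<beta> (Suc t) \<omega> = closest_point W (\<beta> t \<omega> - \<gamma> t *\<^sub>R
        sgc_estimate p d S (\<lambda>j. straggler t j \<omega>) (\<lambda>i. grad (row i A) (\<beta> t \<omega>)))"
    and T: "1 \<le> T"
  shows "(LINT \<omega>|M. (norm (\<beta> T \<omega> - \<beta>star))\<^sup>2)
    \<le> 4 / (lam\<^sup>2 * real T) * (real CARD('m) * C\<^sup>2 *
        (p / (1 - p) * (1 / real (Min (range d)))
         + (real CARD('m) - 1) * p / (real CARD('n) * (1 - p))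
         + real CARD('m)))"
proof -
  interpret prob_space M by (rule M)
  let ?m = "real CARD('m)" and ?n = "real CARD('n)" and ?dm = "real (Min (range d))"
  define B where "B = ?m * C\<^sup>2 * (p / (1 - p) * (1 / ?dm) + (?m - 1) * p / (?n * (1 - p)) + ?m)"
  define I :: "(nat \<times> 'n) set" where "I = {1..} \<times> UNIV"
  \<comment> \<open>Only iterations strictly before \<open>t\<close> count: \<beta> \<open>t\<close>
    is formed before the stragglers of iteration \<open>t\<close> are drawn. \<open>J 1\<close> is
    empty, in line with the deterministic start.\<close>
  define J :: "nat \<Rightarrow> (nat \<times> 'n) set" where "J t = {1..<t} \<times> UNIV" for t
  define X' where "X' = (\<lambda>(t, j). straggler t j)"
  define hist where "hist t \<omega> = (\<lambda>i\<in>J t. X' i \<omega>)" for t \<omega>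
  define G where "G b i = grad (row i A) b" for b i
  define g where "g b = (\<Sum>i\<in>UNIV. G b i)" for b
  define ghat where "ghat t \<omega> = sgc_estimate p d S (\<lambda>j. straggler t j \<omega>) (G (\<beta> t \<omega>))" for t \<omega>
  define a where "a t = expectation (\<lambda>\<omega>. (norm (\<beta> t \<omega> - \<beta>star))\<^sup>2)" for t

  have card_S: "card (S i) = d i" for i using balanced by (simp add: pairwise_balanced_def)
  have ind: "indep_vars (\<lambda>_. count_space UNIV) X' I"
    using straggler_indep by (simp add: X'_def I_def)
  have rv: "random_variable (count_space UNIV) (X' i)" if "i \<in> I" for i
    using ind that unfolding indep_vars_def by blast
  have J: "finite (J t)" "J t \<subseteq> I" for t by (auto simp: J_def I_def)
  have closed_W: "closed W" using W(3) by (rule projection_well_defined_closed)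
  have star: "\<beta>star \<in> W" "total_loss loss A \<beta>star \<le> total_loss loss A w" if "w \<in> W" for w
    using argmin that by (auto simp: is_arg_min_linorder)
  note star_W = star(1)[OF init(1)]
  have gderiv: "GDERIV (total_loss loss A) b :> g b" if "b \<in> W" for b
    unfolding total_loss_def[abs_def] g_def G_def using grad[OF that] by (intro GDERIV_sum)
  have G_bound: "(norm (G b i))\<^sup>2 \<le> C\<^sup>2" if "b \<in> W" for b i
    unfolding G_def using that by (rule grad_bound)
  have descent: "lam * (norm (b - \<beta>star))\<^sup>2 \<le> g b \<bullet> (b - \<beta>star)" if "b \<in> W" for b
    using strongly_convex_inner_minimizer[OF strong W(2) star_W that star(2) gderiv gderiv] star_W that
    by blast
  have g_bound: "(norm (g b))\<^sup>2 \<le> ?m\<^sup>2 * C\<^sup>2" if "b \<in> W" for b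
    unfolding g_def using G_bound[OF that] by (rule norm_sum_le_card)

  \<comment> \<open>The last summand of \<open>B\<close> is the bound on the squared full gradient;
    the rest is the variance caused by stragglers.\<close>
  have B_ge: "?m\<^sup>2 * C\<^sup>2 \<le> B"
  proof -
    have "0 \<le> p / (1 - p) * (1 / ?dm) + (?m - 1) * p / (?n * (1 - p))"
      using p by (intro add_nonneg_nonneg) auto
    then have "?m * C\<^sup>2 * ?m \<le> B" unfolding B_def by (intro mult_left_mono) auto
    then show ?thesis by (simp add: power2_eq_square mult_ac)
  qed
  have B_nonneg: "0 \<le> B" by (rule order_trans[OF _ B_ge]) simp

  have step': "\<beta> (Suc t) \<omega> = closest_point W (\<beta> t \<omega> - \<gamma> t *\<^sub>R ghat t \<omega>)" if "1 \<le> t" "\<omega> \<in> space M" for t \<omega>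
    using step[OF that] by (simp add: ghat_def G_def[abs_def])
  have in_W: "\<beta> t \<omega> \<in> W" if "1 \<le> t" "\<omega> \<in> space M" for t \<omega>
    using that(1)
  proof (induction t rule: dec_induct)
    case base
    then show ?case using init that by simp
  next
    case (step t)
    \<comment> \<open>A point of a closed set is returned by \<open>closest_point\<close> only if
      the set is nonempty; \<open>star_W\<close> provides an element.\<close>
    then show ?case
      using step'[of t \<omega>] that star_W by (auto intro!: closest_point_in_set closed_W)
  qed

  text \<open>No measurability of the gradients is assumed; none is needed, because \<open>\<beta> t\<close> is a function
    of finitely many Booleans.\<close>
  have factor: "\<exists>f. \<forall>\<omega>\<in>space M. \<beta> t \<omega> = f (hist t \<omega>)" if "1 \<le> t" for t
    using that
  proof (induction t rule: dec_induct)
    case base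
    then show ?case using init by auto
  next
    case (step t)
    then obtain f where f: "\<And>\<omega>. \<omega> \<in> space M \<Longrightarrow> \<beta> t \<omega> = f (hist t \<omega>)" by blast
    have "J (Suc t) \<inter> J t = J t" by (auto simp: J_def)
    then have "hist t \<omega> = restrict (hist (Suc t) \<omega>) (J t)" for \<omega>
      by (simp add: hist_def)
    moreover have "straggler t j \<omega> = hist (Suc t) \<omega> (t, j)" for j \<omega>
      using step.hyps by (simp add: hist_def J_def X'_def)
    ultimately have "\<beta> (Suc t) \<omega> = closest_point W (f (restrict (hist (Suc t) \<omega>) (J t)) - \<gamma> t *\<^sub>R
        sgc_estimate p d S (\<lambda>j. hist (Suc t) \<omega> (t, j)) (G (f (restrict (hist (Suc t) \<omega>) (J t)))))"
      if "\<omega> \<in> space M" for \<omega>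
      using step'[of t \<omega>] step.hyps that f[OF that] by (simp add: ghat_def)
    then show ?case by (intro exI ballI)
  qed

  have int_hist: "integrable M (\<lambda>\<omega>. F (hist t \<omega>))" for F :: "_ \<Rightarrow> real" and t
    unfolding hist_def using J(1) rv J(2)[of t] by (intro integrable_finite_restrict) blast+
  \<comment> \<open>The second argument of \<open>F\<close> sees the stragglers of iteration
    \<open>t\<close> itself, so the history up to \<open>Suc t\<close> is used.\<close>
  have int_\<beta>: "integrable M (\<lambda>\<omega>. F (\<beta> t \<omega>) (\<lambda>j. straggler t j \<omega>))"
    if t: "1 \<le> t" for F :: "_ \<Rightarrow> _ \<Rightarrow> real" and t
  proof -
    obtain f where f: "\<And>\<omega>. \<omega> \<in> space M \<Longrightarrow> \<beta> t \<omega> = f (hist t \<omega>)" using factor[OF t] by blast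
    have "J (Suc t) \<inter> J t = J t" by (auto simp: J_def)
    then have h: "hist t \<omega> = restrict (hist (Suc t) \<omega>) (J t)" for \<omega>
      by (simp add: hist_def)
    have s: "straggler t j \<omega> = hist (Suc t) \<omega> (t, j)" for j \<omega>
      using t by (simp add: hist_def J_def X'_def)
    have "integrable M (\<lambda>\<omega>. F (\<beta> t \<omega>) (\<lambda>j. straggler t j \<omega>))
      \<longleftrightarrow> integrable M (\<lambda>\<omega>. F (f (restrict (hist (Suc t) \<omega>) (J t))) (\<lambda>j. hist (Suc t) \<omega> (t, j)))"
      by (intro Bochner_Integration.integrable_cong refl) (simp add: f h s)
    then show ?thesis using int_hist[of "\<lambda>h. F (f (restrict h (J t))) (\<lambda>j. h (t, j))" "Suc t"] by simp
  qed

  have recursion: "a (Suc t) \<le> (1 - 2 / real t) * a t + B / lam\<^sup>2 / (real t)\<^sup>2" if t: "1 \<le> t" for t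
  proof -
    obtain f where f: "\<And>\<omega>. \<omega> \<in> space M \<Longrightarrow> \<beta> t \<omega> = f (hist t \<omega>)" using factor[OF t] by blast
    define v where "v b = worker_part p d S (G b)" for b
    have ghat: "ghat t \<omega> = (\<Sum>j\<in>UNIV. of_bool (\<not> X' (t, j) \<omega>) *\<^sub>R v (\<beta> t \<omega>) j)" for \<omega>
      by (simp add: ghat_def v_def X'_def sgc_estimate_worker_part)
    have sum_v: "(1 - p) *\<^sub>R (\<Sum>j\<in>UNIV. v b j) = g b" for b
      unfolding v_def g_def using p d(1) card_S by (intro sum_worker_part) auto
    have k: "inj (Pair t :: 'n \<Rightarrow> _)" "range (Pair t) \<subseteq> I" "J t \<inter> range (Pair t) = {}"
      using t by (auto simp: I_def J_def inj_on_def)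
    have P: "prob {\<omega> \<in> space M. X' (t, j) \<omega>} = p" for j
      using straggler_prob[OF t] by (simp add: X'_def)
    note moments = weighted_sum_moments[OF ind J(2,1) k P, folded hist_def]

    have "expectation (\<lambda>\<omega>. ghat t \<omega> \<bullet> (\<beta> t \<omega> - \<beta>star))
        = expectation (\<lambda>\<omega>. g (\<beta> t \<omega>) \<bullet> (\<beta> t \<omega> - \<beta>star))"
      \<comment> \<open>Worker contributions and error vector are functions of the history alone,
        through \<open>f\<close>.\<close>
      using moments(1)[of "\<lambda>h. v (f h)" "\<lambda>h. f h - \<beta>star"]
      by (simp add: ghat f sum_v cong: Bochner_Integration.integral_cong)
    also have "\<dots> \<ge> expectation (\<lambda>\<omega>. lam * (norm (\<beta> t \<omega> - \<beta>star))\<^sup>2)"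
      using t by (intro integral_mono int_\<beta>[of t "\<lambda>b _. g b \<bullet> (b - \<beta>star)"]
          int_\<beta>[of t "\<lambda>b _. lam * (norm (b - \<beta>star))\<^sup>2"] descent in_W)
    finally have inner: "lam * a t \<le> expectation (\<lambda>\<omega>. ghat t \<omega> \<bullet> (\<beta> t \<omega> - \<beta>star))"
      by (simp add: a_def)

    have "expectation (\<lambda>\<omega>. (norm (ghat t \<omega>))\<^sup>2)
        = expectation (\<lambda>\<omega>. (norm (g (\<beta> t \<omega>)))\<^sup>2 + p * (1 - p) * (\<Sum>j\<in>UNIV. (norm (v (\<beta> t \<omega>) j))\<^sup>2))"
      using moments(2)[of "\<lambda>h. v (f h)"]
      by (simp only: ghat f sum_v cong: Bochner_Integration.integral_cong)
    also have "\<dots> \<le> B"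
    proof (intro integral_le_const AE_I2)
      show "integrable M (\<lambda>\<omega>. (norm (g (\<beta> t \<omega>)))\<^sup>2 + p * (1 - p) * (\<Sum>j\<in>UNIV. (norm (v (\<beta> t \<omega>) j))\<^sup>2))"
        using int_\<beta>[OF t, of "\<lambda>b _. (norm (g b))\<^sup>2 + p * (1 - p) * (\<Sum>j\<in>UNIV. (norm (v b j))\<^sup>2)"] .
    next
      fix \<omega> assume "\<omega> \<in> space M"
      then have b: "\<beta> t \<omega> \<in> W" using in_W t by blast
      let ?V = "\<Sum>j\<in>UNIV. (norm (v (\<beta> t \<omega>) j))\<^sup>2"
      \<comment> \<open>This exposes the factor \<open>(1 - p)^2\<close> required by
        \<open>sum_norm_worker_part\<close>.\<close>
      have "p * (1 - p) * ?V = p / (1 - p) * ((1 - p)\<^sup>2 * ?V)"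
        using p by (simp add: power2_eq_square)
      also have "\<dots> \<le> p / (1 - p) * (?m * C\<^sup>2 * (1 / ?dm + (?m - 1) / ?n))"
        unfolding v_def using p d(1) balanced G_bound[OF b]
        by (intro mult_left_mono sum_norm_worker_part) auto
      also have "\<dots> = B - ?m\<^sup>2 * C\<^sup>2"
      proof -
        \<comment> \<open>Here \<open>q\<close> stands for \<open>p / (1 - p)\<close>,
          \<open>x\<close> for the number of rows and \<open>c\<close> for the square of
          \<open>C\<close>.\<close>
        have "q * (x * c * (u + w)) = x * c * (q * u + q * w + x) - x\<^sup>2 * c" for q x c u w :: real
          by (simp add: power2_eq_square algebra_simps)
        moreover have "B = ?m * C\<^sup>2 * (p / (1 - p) * (1 / ?dm) + p / (1 - p) * ((?m - 1) / ?n) + ?m)"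
          by (simp add: B_def mult.commute)
        ultimately show ?thesis by presburger
      qed
      finally show "(norm (g (\<beta> t \<omega>)))\<^sup>2 + p * (1 - p) * ?V \<le> B"
        using g_bound[OF b] by simp
    qed
    finally have square: "expectation (\<lambda>\<omega>. (norm (ghat t \<omega>))\<^sup>2) \<le> B" .

    have \<gamma>: "\<gamma> t = 1 / (lam * real t)" "\<gamma> t \<ge> 0" using step_size[OF t] lam by auto
    have int_a: "integrable M (\<lambda>\<omega>. (norm (\<beta> t \<omega> - \<beta>star))\<^sup>2)"
      using int_\<beta>[OF t, of "\<lambda>b _. (norm (b - \<beta>star))\<^sup>2"] .
    have int_i: "integrable M (\<lambda>\<omega>. ghat t \<omega> \<bullet> (\<beta> t \<omega> - \<beta>star))"
      unfolding ghat_def using int_\<beta>[OF t, of "\<lambda>b s. sgc_estimate p d S s (G b) \<bullet> (b - \<beta>star)"] .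
    have int_s: "integrable M (\<lambda>\<omega>. (norm (ghat t \<omega>))\<^sup>2)"
      unfolding ghat_def using int_\<beta>[OF t, of "\<lambda>b s. (norm (sgc_estimate p d S s (G b)))\<^sup>2"] .
    have "a (Suc t) \<le> expectation (\<lambda>\<omega>. (norm (\<beta> t \<omega> - \<beta>star))\<^sup>2
        - 2 * \<gamma> t * (ghat t \<omega> \<bullet> (\<beta> t \<omega> - \<beta>star)) + (\<gamma> t)\<^sup>2 * (norm (ghat t \<omega>))\<^sup>2)"
      unfolding a_def
    proof (rule integral_mono)
      show "integrable M (\<lambda>\<omega>. (norm (\<beta> (Suc t) \<omega> - \<beta>star))\<^sup>2)"
        using int_\<beta>[of "Suc t" "\<lambda>b _. (norm (b - \<beta>star))\<^sup>2"] by simp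
      show "integrable M (\<lambda>\<omega>. (norm (\<beta> t \<omega> - \<beta>star))\<^sup>2
        - 2 * \<gamma> t * (ghat t \<omega> \<bullet> (\<beta> t \<omega> - \<beta>star)) + (\<gamma> t)\<^sup>2 * (norm (ghat t \<omega>))\<^sup>2)"
        using int_a int_i int_s by auto
    next
      fix \<omega> assume \<omega>: "\<omega> \<in> space M"
      have "norm (\<beta> (Suc t) \<omega> - \<beta>star) \<le> norm (\<beta> t \<omega> - \<gamma> t *\<^sub>R ghat t \<omega> - \<beta>star)"
        using dist_closest_point_le[OF W(2) closed_W star_W] by (simp add: step'[OF t \<omega>] dist_norm)
      then have "(norm (\<beta> (Suc t) \<omega> - \<beta>star))\<^sup>2 \<le> (norm ((\<beta> t \<omega> - \<beta>star) - \<gamma> t *\<^sub>R ghat t \<omega>))\<^sup>2"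
        by (simp add: diff_diff_eq add.commute)
      also have "\<dots> = (norm (\<beta> t \<omega> - \<beta>star))\<^sup>2
        - 2 * \<gamma> t * (ghat t \<omega> \<bullet> (\<beta> t \<omega> - \<beta>star)) + (\<gamma> t)\<^sup>2 * (norm (ghat t \<omega>))\<^sup>2"
        by (rule norm_diff_scaleR_square)
      finally show "(norm (\<beta> (Suc t) \<omega> - \<beta>star))\<^sup>2 \<le> (norm (\<beta> t \<omega> - \<beta>star))\<^sup>2
        - 2 * \<gamma> t * (ghat t \<omega> \<bullet> (\<beta> t \<omega> - \<beta>star)) + (\<gamma> t)\<^sup>2 * (norm (ghat t \<omega>))\<^sup>2" .
    qed
    also have "\<dots> = a t - 2 * \<gamma> t * expectation (\<lambda>\<omega>. ghat t \<omega> \<bullet> (\<beta> t \<omega> - \<beta>star))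
        + (\<gamma> t)\<^sup>2 * expectation (\<lambda>\<omega>. (norm (ghat t \<omega>))\<^sup>2)"
      using int_a int_i int_s by (simp add: a_def)
    also have "\<dots> \<le> a t - 2 * \<gamma> t * (lam * a t) + (\<gamma> t)\<^sup>2 * B"
      using inner square \<gamma>(2) by (intro add_mono diff_left_mono mult_left_mono) auto
    \<comment> \<open>The step size makes \<open>2 * \<gamma> t * lam\<close> equal to
      \<open>2 / t\<close>.\<close>
    also have "\<dots> = (1 - 2 / real t) * a t + B / lam\<^sup>2 / (real t)\<^sup>2"
      using lam t by (simp add: \<gamma>(1) field_simps power2_eq_square)
    finally show ?thesis .
  qed

  have a1: "a 1 = (norm (\<beta>1 - \<beta>star))\<^sup>2"
    by (simp add: a_def init(2) prob_space del: One_nat_def cong: Bochner_Integration.integral_cong)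
  have "a 1 \<le> B / lam\<^sup>2"
  \<comment> \<open>One factor \<open>norm (\<beta>1 - \<beta>star)\<close> is to be cancelled, so
    it must be nonzero.\<close>
  proof (cases "\<beta>1 = \<beta>star")
    case False
    have "lam * (norm (\<beta>1 - \<beta>star))\<^sup>2 \<le> norm (g \<beta>1) * norm (\<beta>1 - \<beta>star)"
      using descent[OF init(1)] norm_cauchy_schwarz order_trans by blast
    then have "lam * norm (\<beta>1 - \<beta>star) \<le> norm (g \<beta>1)"
      using False by (simp add: power2_eq_square)
    then have "(lam * norm (\<beta>1 - \<beta>star))\<^sup>2 \<le> (norm (g \<beta>1))\<^sup>2"
      using lam by (intro power_mono) auto
    also have "\<dots> \<le> B" using g_bound[OF init(1)] B_ge by simp
    finally have "(norm (\<beta>1 - \<beta>star))\<^sup>2 * lam\<^sup>2 \<le> B" by (simp add: power_mult_distrib mult.commute)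
    then show ?thesis unfolding a1 using lam by (simp add: pos_le_divide_eq)
  next
    case True
    then show ?thesis unfolding a1 using B_nonneg by simp
  qed
  moreover have D: "0 \<le> B / lam\<^sup>2" using B_nonneg by simp
  ultimately have "a 1 \<le> 4 * (B / lam\<^sup>2)" by linarith
  moreover have "0 \<le> a 1" unfolding a1 by simp
  ultimately have "a T \<le> 4 * (B / lam\<^sup>2) / real T"
    using sgd_recursion_bound[of "B / lam\<^sup>2" a T] D recursion T by blast
  also have "\<dots> = 4 / (lam\<^sup>2 * real T) * B" by simp
  finally show ?thesis unfolding a_def B_def .
qed

end
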